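(* Let $T$ be a reduced $G$-tree. A subgroup $H\subset G$ is bi-elliptic in $T$ if and only if it is contained in a subgroup $K$ having one of the following forms: (1) $K=A\cap B$, where $A$ and $B$ are elliptic in $T$ but $\langle A,B\rangle$ is not elliptic in $T$. (2) $K$ is elliptic in $T$ and there exists a hyperbolic $g\in G$ such that $K\subset gKg^{-1}$. In particular, all reduced trees in a given deformation space have the same bi-elliptic subgroups.
   Context: $G$ is a finitely generated group. A $G$-tree is a simplicial tree $T$ with an action of $G$ by simplicial automorphisms without inversions, always assumed minimal (no proper $G$-invariant subtree). $G_v,G_e$ denote vertex and edge stabilizers. A subgroup or element of $G$ is elliptic in $T$ if it fixes a point of $T$; an element is hyperbolic if it is not elliptic. A deformation space is the set of all $G$-trees having the same elliptic subgroups as a given $G$-tree. $T$ is reduced if, whenever an edge $e=vw$ satisfies $G_e=G_v$, the vertices $v$ and $w$ are in the same $G$-orbit. A subgroup $H$ is bi-elliptic in $T$ if it is contained in some edge stabilizer $G_e$ (equivalently, it fixes two distinct points of $T$). *)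

theory Defs
  imports Complex_Main "HOL-Algebra.Algebra"
begin

definition finitely_generated_group :: "('g, 'm) monoid_scheme \<Rightarrow> bool" where
  "finitely_generated_group G \<longleftrightarrow>
     group G \<and> (\<exists>S. finite S \<and> S \<subseteq> carrier G \<and> generate G S = carrier G)"


section \<open>Simplicial trees\<close>

text \<open>A one-dimensional simplicial complex is given by its vertices and its unoriented edges
  (two-element sets of vertices).\<close>

definition walk :: "'v set \<Rightarrow> 'v set set \<Rightarrow> 'v list \<Rightarrow> bool" where
  "walk V E xs \<longleftrightarrow> xs \<noteq> [] \<and> set xs \<subseteq> V \<and> (\<forall>i. Suc i < length xs \<longrightarrow> {xs ! i, xs ! Suc i} \<in> E)"

definition circuit :: "'v set \<Rightarrow> 'v set set \<Rightarrow> 'v list \<Rightarrow> bool" where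
  "circuit V E xs \<longleftrightarrow> walk V E xs \<and> distinct xs \<and> 3 \<le> length xs \<and> {last xs, hd xs} \<in> E"

definition simplicial_tree :: "'v set \<Rightarrow> 'v set set \<Rightarrow> bool" where
  "simplicial_tree V E \<longleftrightarrow>
     V \<noteq> {} \<and>
     (\<forall>e\<in>E. \<exists>v\<in>V. \<exists>w\<in>V. v \<noteq> w \<and> e = {v, w}) \<and>
     (\<forall>v\<in>V. \<forall>w\<in>V. \<exists>xs. walk V E xs \<and> hd xs = v \<and> last xs = w) \<and>
     (\<nexists>xs. circuit V E xs)"


section \<open>\<open>G\<close>-trees\<close>

record ('g, 'v) action_tree =
  vertices :: "'v set"
  edges :: "'v set set"
  act :: "'g \<Rightarrow> 'v \<Rightarrow> 'v"

definition invariant_subtree ::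
    "('g, 'm) monoid_scheme \<Rightarrow> ('g, 'v) action_tree \<Rightarrow> 'v set \<Rightarrow> 'v set set \<Rightarrow> bool" where
  "invariant_subtree G T V E \<longleftrightarrow>
     V \<subseteq> vertices T \<and> E \<subseteq> edges T \<and> simplicial_tree V E \<and>
     (\<forall>g\<in>carrier G. (\<forall>v\<in>V. act T g v \<in> V) \<and> (\<forall>e\<in>E. act T g ` e \<in> E))"

definition G_tree :: "('g, 'm) monoid_scheme \<Rightarrow> ('g, 'v) action_tree \<Rightarrow> bool" where
  "G_tree G T \<longleftrightarrow>
     simplicial_tree (vertices T) (edges T) \<and>
     group_action G (vertices T) (act T) \<and>
     (\<forall>g\<in>carrier G. \<forall>e\<in>edges T. act T g ` e \<in> edges T) \<and>
     \<comment> \<open>no inversions\<close>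
     (\<forall>g\<in>carrier G. \<forall>v w. {v, w} \<in> edges T \<longrightarrow> \<not> (act T g v = w \<and> act T g w = v)) \<and>
     \<comment> \<open>minimality\<close>
     (\<forall>V E. invariant_subtree G T V E \<longrightarrow> V = vertices T \<and> E = edges T)"

abbreviation vertex_stabilizer ::
    "('g, 'm) monoid_scheme \<Rightarrow> ('g, 'v) action_tree \<Rightarrow> 'v \<Rightarrow> 'g set" where
  "vertex_stabilizer G T v \<equiv> stabilizer G (act T) v"

text \<open>In the absence of inversions, the setwise stabilizer of an edge fixes it pointwise.\<close>

definition edge_stabilizer ::
    "('g, 'm) monoid_scheme \<Rightarrow> ('g, 'v) action_tree \<Rightarrow> 'v set \<Rightarrow> 'g set" where
  "edge_stabilizer G T e = {g \<in> carrier G. act T g ` e = e}"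

definition reduced :: "('g, 'm) monoid_scheme \<Rightarrow> ('g, 'v) action_tree \<Rightarrow> bool" where
  "reduced G T \<longleftrightarrow>
     (\<forall>v w. {v, w} \<in> edges T \<and> edge_stabilizer G T {v, w} = vertex_stabilizer G T v \<longrightarrow>
        w \<in> orbit G (act T) v)"


section \<open>Elliptic and hyperbolic\<close>

text \<open>The points of the geometric realization, in barycentric coordinates: nonnegative functions
  of total mass 1 whose support is a simplex. Such a function vanishes off the vertex set.\<close>

definition points :: "('g, 'v) action_tree \<Rightarrow> ('v \<Rightarrow> real) set" where
  "points T = {p. (\<forall>v. 0 \<le> p v) \<and>
     {v. p v \<noteq> 0} \<in> (\<lambda>v. {v}) ` vertices T \<union> edges T \<and>
     (\<Sum>v | p v \<noteq> 0. p v) = 1}"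

text \<open>The simplicial extension of the action: \<open>g\<close> carries the coordinate at \<open>v\<close> to \<open>g v\<close>.\<close>

definition act_point ::
    "('g, 'm) monoid_scheme \<Rightarrow> ('g, 'v) action_tree \<Rightarrow> 'g \<Rightarrow> ('v \<Rightarrow> real) \<Rightarrow> 'v \<Rightarrow> real" where
  "act_point G T g p = (\<lambda>v. if v \<in> vertices T then p (act T (inv\<^bsub>G\<^esub> g) v) else 0)"

definition elliptic :: "('g, 'm) monoid_scheme \<Rightarrow> ('g, 'v) action_tree \<Rightarrow> 'g set \<Rightarrow> bool" where
  "elliptic G T A \<longleftrightarrow> (\<exists>p\<in>points T. \<forall>a\<in>A. act_point G T a p = p)"

definition hyperbolic :: "('g, 'm) monoid_scheme \<Rightarrow> ('g, 'v) action_tree \<Rightarrow> 'g \<Rightarrow> bool" where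
  "hyperbolic G T g \<longleftrightarrow> g \<in> carrier G \<and> \<not> elliptic G T {g}"

definition bi_elliptic :: "('g, 'm) monoid_scheme \<Rightarrow> ('g, 'v) action_tree \<Rightarrow> 'g set \<Rightarrow> bool" where
  "bi_elliptic G T H \<longleftrightarrow> (\<exists>e\<in>edges T. H \<subseteq> edge_stabilizer G T e)"

text \<open>The deformation space of \<open>T\<close>. The vertex type \<open>'w\<close> of its members need not be the vertex
  type of \<open>T\<close>.\<close>

definition deformation_space ::
    "('g, 'm) monoid_scheme \<Rightarrow> ('g, 'v) action_tree \<Rightarrow> ('g, 'w) action_tree set" where
  "deformation_space G T =
     {T'. G_tree G T' \<and> (\<forall>H. subgroup H G \<longrightarrow> elliptic G T' H = elliptic G T H)}"

end

theory Submission
  imports Defs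
begin

text \<open>Since there are no inversions, a subgroup is elliptic iff it is contained in a vertex
  stabilizer. A subgroup fixing two distinct vertices fixes the geodesic between them, hence an
  edge; this covers \<open>A \<inter> B\<close> in form (1), and \<open>K \<subseteq> gKg\<^sup>-\<^sup>1\<close> in form (2), which fixes \<open>v\<close> and \<open>gv\<close>.
  Conversely, let \<open>H \<subseteq> G\<^sub>e\<close> with \<open>e = vw\<close>. If \<open>G\<^sub>e\<close> is a proper subgroup of both \<open>G\<^sub>v\<close> and \<open>G\<^sub>w\<close>, a
  common fixed vertex of \<open>G\<^sub>v\<close> and \<open>G\<^sub>w\<close> would lie on one side of \<open>e\<close>, forcing one of them to fix \<open>e\<close>;
  so \<open>G\<^sub>e = G\<^sub>v \<inter> G\<^sub>w\<close> has form (1). If \<open>G\<^sub>e = G\<^sub>v\<close>, reducedness gives \<open>w = gv\<close>; such a \<open>g\<close> is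
  hyperbolic, because an automorphism fixing a vertex \<open>x\<close> preserves the distance to \<open>x\<close>, while
  adjacent vertices have different distances to \<open>x\<close>. So \<open>G\<^sub>v\<close> has form (2).\<close>

section \<open>Geodesics in simplicial trees\<close>

lemma walk_iff_successively:
  "walk V E xs \<longleftrightarrow> xs \<noteq> [] \<and> set xs \<subseteq> V \<and> successively (\<lambda>x y. {x, y} \<in> E) xs"
  by (simp add: walk_def successively_conv_nth)

text \<open>In a simplicial tree this is the geodesic from \<open>x\<close> to \<open>y\<close>; the
  list is one longer than the distance.\<close>

definition simple_path :: "'v set \<Rightarrow> 'v set set \<Rightarrow> 'v \<Rightarrow> 'v \<Rightarrow> 'v list \<Rightarrow> bool" where
  "simple_path V E x y xs \<longleftrightarrow> walk V E xs \<and> distinct xs \<and> hd xs = x \<and> last xs = y"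

lemma simple_path_Cons:
  assumes "simple_path V E w x xs" "{v, w} \<in> E" "v \<in> V" "v \<notin> set xs"
  shows "simple_path V E v x (v # xs)"
  using assms by (auto simp: simple_path_def walk_iff_successively successively_Cons)

lemma simple_path_suffix:
  assumes "simple_path V E w x (ys @ v # zs)"
  shows "simple_path V E v x (v # zs)"
  using assms by (auto simp: simple_path_def walk_iff_successively successively_append_iff)

lemma walk_imp_simple_path:
  assumes "walk V E xs"
  shows "\<exists>ys. simple_path V E (hd xs) (last xs) ys"
  using assms
proof (induction xs)
  case Nil
  then show ?case by (simp add: walk_def)
next
  case (Cons a xs)
  show ?case
  proof (cases "xs = []")
    case True
    with Cons.prems have "simple_path V E a a [a]"
      by (simp add: simple_path_def)
    with True show ?thesis by auto
  next
    case False
    with Cons.prems have "walk V E xs" "{a, hd xs} \<in> E" "a \<in> V"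
      by (auto simp: walk_iff_successively successively_Cons)
    with Cons.IH obtain ys where ys: "simple_path V E (hd xs) (last xs) ys" by blast
    show ?thesis
    proof (cases "a \<in> set ys")
      case True
      \<comment> \<open>The loop through \<open>a\<close> is cut out: the suffix starting at
        \<open>a\<close> is already a simple path to the end.\<close>
      then obtain us zs where "ys = us @ a # zs" by (meson split_list)
      with ys simple_path_suffix False show ?thesis by fastforce
    next
      case a: False
      from simple_path_Cons[OF ys \<open>{a, hd xs} \<in> E\<close> \<open>a \<in> V\<close> a] False show ?thesis by auto
    qed
  qed
qed

text \<open>Two different simple paths with the same ends separate after a common vertex and meet
  again later, so they bound a circuit.\<close>

lemma simple_path_unique:
  assumes "\<nexists>xs. circuit V E xs" "simple_path V E x y xs" "simple_path V E x y ys"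
  shows "xs = ys"
  using assms(2,3)
proof (induction xs arbitrary: x ys)
  case Nil
  then show ?case by (simp add: simple_path_def walk_def)
next
  case (Cons a xs)
  from Cons.prems obtain ys' where ys: "ys = a # ys'"
    by (cases ys) (auto simp: simple_path_def walk_def)
  show ?case
  proof (cases "xs = [] \<or> ys' = []")
    case True
    then show ?thesis
      using Cons.prems by (auto simp: ys simple_path_def split: if_splits)
  next
    case False
    then have xs': "simple_path V E (hd xs) y xs" and ys': "simple_path V E (hd ys') y ys'"
      and edges: "{a, hd xs} \<in> E" "{a, hd ys'} \<in> E"
      and a: "a \<in> V" "a \<notin> set xs" "a \<notin> set ys'"
      using Cons.prems by (auto simp: ys simple_path_def walk_iff_successively successively_Cons)
    show ?thesis
    proof (cases "hd xs = hd ys'")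
      case True
      with Cons.IH xs' ys' show ?thesis by (simp add: ys)
    next
      case ne: False
      \<comment> \<open>The tails share their last vertex, so \<open>xs\<close> has a first vertex
        \<open>z\<close> on \<open>ys'\<close>; hence \<open>p1\<close> avoids
        \<open>ys'\<close>.\<close>
      have "last xs \<in> set xs" "last xs = last ys'" "last ys' \<in> set ys'"
        using xs' ys' last_in_set[of xs] last_in_set[of ys'] False by (auto simp: simple_path_def)
      then have "\<exists>z\<in>set xs. z \<in> set ys'" by auto
      then obtain p1 z p2 where p: "xs = p1 @ z # p2" "z \<in> set ys'" "\<forall>u\<in>set p1. u \<notin> set ys'"
        by (rule split_list_first_propE)
      from p(2) obtain q1 q2 where q: "ys' = q1 @ z # q2" by (meson split_list)
      \<comment> \<open>Out from \<open>a\<close> along \<open>xs\<close> to \<open>z\<close> and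
        back along \<open>ys'\<close>. As the heads differ, \<open>p1\<close> and \<open>q1\<close>
        are not both empty, which gives at least three vertices.\<close>
      define c where "c = a # p1 @ z # rev q1"
      have "walk V E c"
        using xs' ys' edges a unfolding c_def p(1) q
        by (auto simp: simple_path_def walk_iff_successively successively_Cons
            successively_append_iff hd_append last_rev insert_commute hd_rev split: if_splits)
      moreover have "distinct c"
        using xs' ys' a p(3) unfolding c_def p(1) q by (auto simp: simple_path_def)
      moreover have "3 \<le> length c"
        using ne unfolding c_def p(1) q by (cases p1; cases q1) auto
      moreover have "{last c, hd c} \<in> E"
        using edges unfolding c_def p(1) q
        by (cases q1) (auto simp: insert_commute)
      ultimately have "circuit V E c" by (simp add: circuit_def)
      with assms(1) show ?thesis by blast
    qed
  qed
qed

lemma simplicial_tree_simple_path_exists: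
  assumes "simplicial_tree V E" "x \<in> V" "y \<in> V"
  obtains xs where "simple_path V E x y xs"
  using assms walk_imp_simple_path unfolding simplicial_tree_def by metis

lemma simplicial_tree_simple_path_unique:
  assumes "simplicial_tree V E" "simple_path V E x y xs" "simple_path V E x y ys"
  shows "xs = ys"
  using assms simple_path_unique unfolding simplicial_tree_def by metis

lemma simplicial_tree_edge:
  assumes "simplicial_tree V E" "{v, w} \<in> E"
  shows "v \<in> V" "w \<in> V" "v \<noteq> w"
  using assms unfolding simplicial_tree_def by (fastforce simp: doubleton_eq_iff)+

text \<open>The geodesic from \<open>w\<close> to \<open>x\<close> either avoids \<open>v\<close>,
  which can then be prepended, or contains it, and then its part from \<open>v\<close> on avoids
  \<open>w\<close>. The two cases tell on which side of the edge \<open>x\<close> lies.\<close>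

lemma simplicial_tree_edge_towards:
  assumes tree: "simplicial_tree V E" and e: "{v, w} \<in> E" and "x \<in> V"
  obtains xs where "simple_path V E w x xs" "simple_path V E v x (v # xs)"
    | xs where "simple_path V E v x xs" "simple_path V E w x (w # xs)"
proof -
  note vw = simplicial_tree_edge[OF tree e]
  obtain xs where xs: "simple_path V E w x xs"
    using simplicial_tree_simple_path_exists[OF tree vw(2) \<open>x \<in> V\<close>] .
  show ?thesis
  proof (cases "v \<in> set xs")
    case False
    from that(1)[OF xs simple_path_Cons[OF xs e vw(1) False]] show ?thesis .
  next
    case True
    then obtain us zs where us: "xs = us @ v # zs" by (meson split_list)
    have vz: "simple_path V E v x (v # zs)"
      using simple_path_suffix xs us by metis
    have "w \<notin> set (v # zs)"
      using xs vw(3) unfolding us by (cases us) (auto simp: simple_path_def)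
    then have "simple_path V E w x (w # v # zs)"
      using simple_path_Cons[OF vz _ vw(2)] e by (simp add: insert_commute)
    with vz that(2) show ?thesis by blast
  qed
qed

section \<open>Fixed vertices in \<open>G\<close>-trees\<close>

locale tree_action = group_action G "vertices T" "act T"
  for G :: "('g, 'm) monoid_scheme" and T :: "('g, 'v) action_tree" +
  assumes tree: "simplicial_tree (vertices T) (edges T)"
    and act_edge: "\<And>g e. g \<in> carrier G \<Longrightarrow> e \<in> edges T \<Longrightarrow> act T g ` e \<in> edges T"
    and no_inversion: "\<And>g v w. g \<in> carrier G \<Longrightarrow> {v, w} \<in> edges T \<Longrightarrow>
      \<not> (act T g v = w \<and> act T g w = v)"
begin

lemma act_simple_path:
  assumes g: "g \<in> carrier G" and xs: "simple_path (vertices T) (edges T) x y xs"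
  shows "simple_path (vertices T) (edges T) (act T g x) (act T g y) (map (act T g) xs)"
proof -
  have "set xs \<subseteq> vertices T" using xs by (auto simp: simple_path_def walk_def)
  moreover have "inj_on (act T g) (vertices T)" using inj_prop[OF g] .
  moreover have "{act T g u, act T g w} \<in> edges T" if "{u, w} \<in> edges T" for u w
    using act_edge[OF g that] by simp
  ultimately show ?thesis
    using xs g element_image
    by (auto simp: simple_path_def walk_def distinct_map hd_map last_map inj_on_subset)
qed

text \<open>The image of the geodesic is a geodesic with the same ends, so by uniqueness it is the
  same list, entry by entry.\<close>

lemma fixes_simple_path:
  assumes "g \<in> carrier G" "simple_path (vertices T) (edges T) x y xs"
    "act T g x = x" "act T g y = y" "u \<in> set xs"
  shows "act T g u = u"
proof -
  have "map (act T g) xs = xs"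
    using act_simple_path[OF assms(1,2)] assms(2-4) simplicial_tree_simple_path_unique[OF tree]
    by metis
  then show ?thesis using assms(5) by (metis map_idI map_eq_conv list.map_ident)
qed

text \<open>An element preserving the pair fixes both vertices or swaps them, and a swap is an
  inversion.\<close>

lemma edge_stabilizer_eq:
  assumes "{v, w} \<in> edges T"
  shows "edge_stabilizer G T {v, w} = stabilizer G (act T) v \<inter> stabilizer G (act T) w"
  using no_inversion[OF _ assms]
  by (auto simp: edge_stabilizer_def stabilizer_def doubleton_eq_iff)

lemma bi_elliptic_if_fixes_two_vertices:
  assumes "v \<in> vertices T" "w \<in> vertices T" "v \<noteq> w"
    "H \<subseteq> stabilizer G (act T) v" "H \<subseteq> stabilizer G (act T) w"
  shows "bi_elliptic G T H"
proof -
  obtain xs where xs: "simple_path (vertices T) (edges T) v w xs"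
    using simplicial_tree_simple_path_exists[OF tree assms(1,2)] .
  \<comment> \<open>As \<open>v\<close> and \<open>w\<close> differ, the geodesic has a second
    vertex \<open>u\<close>; its first edge is the one that \<open>H\<close> fixes.\<close>
  then obtain u us where us: "xs = v # u # us"
    using assms(3) by (cases xs; cases "tl xs") (auto simp: simple_path_def walk_def)
  have e: "{v, u} \<in> edges T"
    using xs by (simp add: us simple_path_def walk_iff_successively)
  have "act T h u = u" if "h \<in> H" for h
    using that assms(4,5) fixes_simple_path[OF _ xs] by (auto simp: us stabilizer_def)
  then have "H \<subseteq> edge_stabilizer G T {v, u}"
    using assms(4) by (auto simp: edge_stabilizer_def stabilizer_def)
  with e show ?thesis by (auto simp: bi_elliptic_def)
qed

text \<open>The support of a fixed point is an invariant vertex or edge, whose vertices are fixed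
  for lack of inversions; conversely a vertex is itself a point. Subsets are allowed so that
  \<open>{g}\<close> and \<open>A \<union> B\<close> are covered.\<close>

lemma elliptic_iff_subset_stabilizer:
  assumes A: "A \<subseteq> carrier G"
  shows "elliptic G T A \<longleftrightarrow> (\<exists>v\<in>vertices T. A \<subseteq> stabilizer G (act T) v)"
proof
  assume "elliptic G T A"
  then obtain p where p: "p \<in> points T" "\<And>a. a \<in> A \<Longrightarrow> act_point G T a p = p"
    by (auto simp: elliptic_def)
  define S where "S = {v. p v \<noteq> 0}"
  have S: "S \<in> (\<lambda>v. {v}) ` vertices T \<union> edges T"
    using p(1) by (simp add: points_def S_def)
  have SV: "S \<subseteq> vertices T"
    using S tree by (auto simp: simplicial_tree_def)
  have inv: "act T a u \<in> S" if a: "a \<in> A" and u: "u \<in> S" for a u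
  proof -
    from a A have aG: "a \<in> carrier G" by auto
    from u SV have uV: "u \<in> vertices T" by auto
    \<comment> \<open>The coordinate of \<open>p\<close> at \<open>u\<close> reappears at
      \<open>act T a u\<close>, so \<open>a\<close> preserves the support.\<close>
    have "act T (inv\<^bsub>G\<^esub> a) (act T a u) = u"
      using orbit_sym_aux[OF aG uV] by simp
    then have "act_point G T a p (act T a u) = p u"
      using element_image[OF aG uV] by (simp add: act_point_def)
    with p(2)[OF a] u show ?thesis by (simp add: S_def)
  qed
  have "S \<noteq> {}" using S tree by (fastforce simp: simplicial_tree_def)
  with SV obtain u where u: "u \<in> S" "u \<in> vertices T" by blast
  have "act T a u = u" if a: "a \<in> A" for a
  proof (cases "S \<in> edges T")
    case False
    with S u inv[OF a u(1)] show ?thesis by auto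
  next
    case True
    from a A have aG: "a \<in> carrier G" by auto
    from True obtain x y where "S = {x, y}" "x \<noteq> y"
      using tree unfolding simplicial_tree_def by meson
    with u obtain w where w: "S = {u, w}" "u \<noteq> w" by auto
    have "act T a u \<in> {u, w}" "act T a w \<in> {u, w}" using inv[OF a] w by auto
    moreover have "act T a u \<noteq> act T a w"
      using inj_prop[OF aG] w SV by (auto dest: inj_onD)
    ultimately show ?thesis using no_inversion[OF aG] True w by auto
  qed
  with A u show "\<exists>v\<in>vertices T. A \<subseteq> stabilizer G (act T) v"
    by (auto simp: stabilizer_def)
next
  assume "\<exists>v\<in>vertices T. A \<subseteq> stabilizer G (act T) v"
  then obtain v where v: "v \<in> vertices T" "A \<subseteq> stabilizer G (act T) v" by blast
  \<comment> \<open>The vertex \<open>v\<close> in barycentric coordinates: unit mass at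
    \<open>v\<close>.\<close>
  define p :: "'v \<Rightarrow> real" where "p u = (if u = v then 1 else 0)" for u
  have "{u. p u \<noteq> 0} = {v}" by (auto simp: p_def)
  then have "p \<in> points T" using v(1) by (auto simp: points_def p_def)
  moreover have "act_point G T a p = p" if a: "a \<in> A" for a
  proof
    fix u
    from a A have aG: "a \<in> carrier G" by auto
    have av: "act T a v = v" using a v(2) by (auto simp: stabilizer_def)
    have "act T (inv\<^bsub>G\<^esub> a) u = v \<longleftrightarrow> u = v" if u: "u \<in> vertices T"
    proof
      assume "act T (inv\<^bsub>G\<^esub> a) u = v"
      moreover have "inv\<^bsub>G\<^esub> a \<in> carrier G"
        using aG group_hom group_hom.axioms(1) group.inv_closed by metis
      ultimately have "act T (inv\<^bsub>G\<^esub> (inv\<^bsub>G\<^esub> a)) v = u"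
        using orbit_sym_aux u by metis
      then show "u = v"
        using av aG group_hom group_hom.axioms(1) group.inv_inv by metis
    next
      assume "u = v"
      with orbit_sym_aux[OF aG v(1) av] show "act T (inv\<^bsub>G\<^esub> a) u = v" by simp
    qed
    \<comment> \<open>Off the vertex set \<open>act_point\<close> takes the value 0, and so does
      \<open>p\<close>, because \<open>v\<close> is a vertex.\<close>
    with v(1) show "act_point G T a p u = p u" by (auto simp: act_point_def p_def)
  qed
  ultimately show "elliptic G T A" by (auto simp: elliptic_def)
qed

text \<open>A vertex stabilizer is a subgroup, so it contains a set exactly when it contains the
  subgroup generated by it.\<close>

lemma elliptic_generate_iff:
  assumes A: "A \<subseteq> carrier G"
  shows "elliptic G T (generate G A) \<longleftrightarrow> elliptic G T A"
proof -
  have G: "group G" using group_hom group_hom.axioms(1) by metis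
  have "generate G A \<subseteq> stabilizer G (act T) v \<longleftrightarrow> A \<subseteq> stabilizer G (act T) v"
    if "v \<in> vertices T" for v
    using stabilizer_subgroup[OF that] group.generate_subgroup_incl[OF G]
      generate.incl[of _ A G] by blast
  then show ?thesis
    using A group.generate_incl[OF G A] by (auto simp: elliptic_iff_subset_stabilizer)
qed

section \<open>Adjacent vertices: hyperbolic translations and comparison of stabilizers\<close>

lemma adjacent_translate_hyperbolic:
  assumes g: "g \<in> carrier G" and e: "{v, act T g v} \<in> edges T"
  shows "hyperbolic G T g"
proof -
  have False if x: "x \<in> vertices T" "act T g x = x" for x
  proof -
    have len: "length ys = length xs"
      if "simple_path (vertices T) (edges T) v x xs"
        "simple_path (vertices T) (edges T) (act T g v) x ys" for xs ys
      using simplicial_tree_simple_path_unique[OF tree that(2)]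
        act_simple_path[OF g that(1)] x(2) by fastforce
    \<comment> \<open>One of the geodesics from the two ends of the edge to \<open>x\<close> has one
      vertex more than the other, against \<open>len\<close>.\<close>
    show False
      using simplicial_tree_edge_towards[OF tree e x(1)] len
      by (metis impossible_Cons le_refl)
  qed
  then show ?thesis
    using g elliptic_iff_subset_stabilizer[of "{g}"]
    by (auto simp: hyperbolic_def stabilizer_def)
qed

text \<open>The geodesic to \<open>x\<close> from the farther end of the edge crosses the edge. The
  stabilizer of that end fixes both ends of this geodesic, hence also the nearer end of the
  edge.\<close>

lemma stabilizer_subset_edge_stabilizer:
  assumes e: "{v, w} \<in> edges T" and x: "x \<in> vertices T"
    and v: "stabilizer G (act T) v \<subseteq> stabilizer G (act T) x"
    and w: "stabilizer G (act T) w \<subseteq> stabilizer G (act T) x"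
  shows "stabilizer G (act T) v = edge_stabilizer G T {v, w} \<or>
    stabilizer G (act T) w = edge_stabilizer G T {v, w}"
  using tree e x
proof (cases rule: simplicial_tree_edge_towards)
  case (1 xs)
  then have "w \<in> set (v # xs)" by (auto simp: simple_path_def walk_def)
  then have "stabilizer G (act T) v \<subseteq> stabilizer G (act T) w"
    using fixes_simple_path[OF _ 1(2)] v by (auto simp: stabilizer_def)
  then show ?thesis using edge_stabilizer_eq[OF e] by blast
next
  case (2 xs)
  then have "v \<in> set (w # xs)" by (auto simp: simple_path_def walk_def)
  then have "stabilizer G (act T) w \<subseteq> stabilizer G (act T) v"
    using fixes_simple_path[OF _ 2(2)] w by (auto simp: stabilizer_def)
  then show ?thesis using edge_stabilizer_eq[OF e] by blast
qed

section \<open>Conjugates and ascending stabilizers\<close>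

lemma mem_conjugate_iff:
  assumes "g \<in> carrier G" "K \<subseteq> carrier G" "k \<in> carrier G"
  shows "k \<in> g <#\<^bsub>G\<^esub> K #>\<^bsub>G\<^esub> inv\<^bsub>G\<^esub> g \<longleftrightarrow> inv\<^bsub>G\<^esub> g \<otimes>\<^bsub>G\<^esub> k \<otimes>\<^bsub>G\<^esub> g \<in> K"
proof -
  interpret group G using group_hom group_hom.axioms(1) by metis
  have "k = g \<otimes>\<^bsub>G\<^esub> h \<otimes>\<^bsub>G\<^esub> inv\<^bsub>G\<^esub> g \<longleftrightarrow> h = inv\<^bsub>G\<^esub> g \<otimes>\<^bsub>G\<^esub> k \<otimes>\<^bsub>G\<^esub> g"
    if "h \<in> carrier G" for h
    using that assms by (metis inv_solve_left inv_solve_right' m_assoc m_closed inv_closed)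
  moreover have "k \<in> g <#\<^bsub>G\<^esub> K #>\<^bsub>G\<^esub> inv\<^bsub>G\<^esub> g \<longleftrightarrow>
      (\<exists>h\<in>K. k = g \<otimes>\<^bsub>G\<^esub> h \<otimes>\<^bsub>G\<^esub> inv\<^bsub>G\<^esub> g)"
    by (auto simp: l_coset_def r_coset_def)
  ultimately show ?thesis
    using assms(2) by (metis subsetD)
qed

text \<open>Elementwise form of the identity \<open>Stab(g v) = g Stab(v) g^-1\<close>.\<close>

lemma conjugate_mem_stabilizer_iff:
  assumes "g \<in> carrier G" "k \<in> carrier G" "v \<in> vertices T"
  shows "inv\<^bsub>G\<^esub> g \<otimes>\<^bsub>G\<^esub> k \<otimes>\<^bsub>G\<^esub> g \<in> stabilizer G (act T) v \<longleftrightarrow>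
    k \<in> stabilizer G (act T) (act T g v)"
proof -
  interpret group G using group_hom group_hom.axioms(1) by metis
  have gv: "act T g v \<in> vertices T" using element_image[OF assms(1,3) refl] .
  have kgv: "act T k (act T g v) \<in> vertices T" using element_image[OF assms(2) gv refl] .
  have "act T (inv\<^bsub>G\<^esub> g \<otimes>\<^bsub>G\<^esub> k \<otimes>\<^bsub>G\<^esub> g) v = act T (inv\<^bsub>G\<^esub> g) (act T k (act T g v))"
    using assms gv by (simp add: composition_rule)
  moreover have "act T (inv\<^bsub>G\<^esub> g) u = v \<longleftrightarrow> u = act T g v" if "u \<in> vertices T" for u
    using orbit_sym_aux[OF assms(1,3)] orbit_sym_aux[OF inv_closed[OF assms(1)] that] assms(1)
    by auto
  ultimately show ?thesis using assms kgv by (simp add: stabilizer_def)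
qed

text \<open>Any \<open>g\<close> taking \<open>v\<close> to \<open>w\<close> witnesses form (2): the
  stabilizer of \<open>w\<close> is the conjugate by \<open>g\<close> of that of \<open>v\<close>,
  and \<open>g\<close> moves \<open>v\<close> to an adjacent vertex.\<close>

lemma ascending_stabilizer:
  assumes e: "{v, w} \<in> edges T" and w: "w \<in> orbit G (act T) v"
    and le: "stabilizer G (act T) v \<subseteq> stabilizer G (act T) w"
  shows "elliptic G T (stabilizer G (act T) v) \<and> (\<exists>g. hyperbolic G T g \<and>
    stabilizer G (act T) v \<subseteq> g <#\<^bsub>G\<^esub> stabilizer G (act T) v #>\<^bsub>G\<^esub> inv\<^bsub>G\<^esub> g)"
proof -
  have v: "v \<in> vertices T" using simplicial_tree_edge[OF tree e] by simp
  have sub: "stabilizer G (act T) v \<subseteq> carrier G" by (auto simp: stabilizer_def)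
  from w obtain g where g: "g \<in> carrier G" "w = act T g v" by (auto simp: orbit_def)
  have "stabilizer G (act T) v \<subseteq> g <#\<^bsub>G\<^esub> stabilizer G (act T) v #>\<^bsub>G\<^esub> inv\<^bsub>G\<^esub> g"
  proof
    fix k assume k: "k \<in> stabilizer G (act T) v"
    with sub have "k \<in> carrier G" by auto
    with k le g v sub show "k \<in> g <#\<^bsub>G\<^esub> stabilizer G (act T) v #>\<^bsub>G\<^esub> inv\<^bsub>G\<^esub> g"
      by (auto simp: mem_conjugate_iff conjugate_mem_stabilizer_iff)
  qed
  moreover have "hyperbolic G T g" using adjacent_translate_hyperbolic g e by simp
  moreover have "elliptic G T (stabilizer G (act T) v)"
    using elliptic_iff_subset_stabilizer[OF sub] v by auto
  ultimately show ?thesis by auto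
qed

section \<open>Characterization of bi-elliptic subgroups\<close>

lemma bi_elliptic_iff:
  assumes red: "reduced G T" and H: "subgroup H G"
  shows "bi_elliptic G T H \<longleftrightarrow>
    (\<exists>K. subgroup K G \<and> H \<subseteq> K \<and>
      ((\<exists>A B. subgroup A G \<and> subgroup B G \<and> K = A \<inter> B \<and>
          elliptic G T A \<and> elliptic G T B \<and> \<not> elliptic G T (generate G (A \<union> B))) \<or>
       (elliptic G T K \<and>
          (\<exists>g. hyperbolic G T g \<and> K \<subseteq> g <#\<^bsub>G\<^esub> K #>\<^bsub>G\<^esub> inv\<^bsub>G\<^esub> g))))"
  (is "_ \<longleftrightarrow> (\<exists>K. subgroup K G \<and> H \<subseteq> K \<and> (?amalgam K \<or> ?ascending K))")
proof
  let ?S = "stabilizer G (act T)"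
  assume "bi_elliptic G T H"
  then obtain e where "e \<in> edges T" "H \<subseteq> edge_stabilizer G T e"
    unfolding bi_elliptic_def by blast
  moreover from this obtain v w where "e = {v, w}"
    using tree unfolding simplicial_tree_def by meson
  \<comment> \<open>Both orientations are kept, since \<open>reduced\<close> treats the two ends of
    an edge asymmetrically.\<close>
  ultimately have e: "{v, w} \<in> edges T" "{w, v} \<in> edges T"
    and HS: "H \<subseteq> ?S v \<inter> ?S w" by (auto simp: edge_stabilizer_eq insert_commute)
  note vw = simplicial_tree_edge[OF tree e(1)]
  note sub = stabilizer_subgroup[OF vw(1)] stabilizer_subgroup[OF vw(2)]
  have SG: "?S u \<subseteq> carrier G" for u by (auto simp: stabilizer_def)
  note ediff = edge_stabilizer_eq[OF e(1)] edge_stabilizer_eq[OF e(2)]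
  \<comment> \<open>As the edge stabilizer is the intersection, an inclusion makes it equal to a
    vertex stabilizer, and reducedness applies.\<close>
  consider "?S v \<subseteq> ?S w" | "?S w \<subseteq> ?S v" | "\<not> ?S v \<subseteq> ?S w" "\<not> ?S w \<subseteq> ?S v" by blast
  then show "\<exists>K. subgroup K G \<and> H \<subseteq> K \<and> (?amalgam K \<or> ?ascending K)"
  proof cases
    case 1
    then have "w \<in> orbit G (act T) v" using red e(1) ediff unfolding reduced_def by blast
    from ascending_stabilizer[OF e(1) this 1] sub(1) HS show ?thesis
      by (intro exI[of _ "?S v"] conjI disjI2) simp_all
  next
    case 2
    then have "v \<in> orbit G (act T) w" using red e(2) ediff unfolding reduced_def by blast
    from ascending_stabilizer[OF e(2) this 2] sub(2) HS show ?thesis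
      by (intro exI[of _ "?S w"] conjI disjI2) simp_all
  next
    case 3
    \<comment> \<open>A common fixed vertex would make the edge stabilizer equal to
      \<open>?S v\<close> or \<open>?S w\<close>, hence one of these contained in the other.\<close>
    have "\<not> elliptic G T (?S v \<union> ?S w)"
      using stabilizer_subset_edge_stabilizer[OF e(1)] 3 ediff(1) SG
      by (subst elliptic_iff_subset_stabilizer) blast+
    moreover have "elliptic G T (?S v)" "elliptic G T (?S w)"
      using vw SG by (auto simp: elliptic_iff_subset_stabilizer)
    moreover have "?S v \<union> ?S w \<subseteq> carrier G" using SG by blast
    ultimately have "?amalgam (?S v \<inter> ?S w)"
      using sub by (intro exI[of _ "?S v"] exI[of _ "?S w"] conjI refl)
        (simp_all add: elliptic_generate_iff)
    moreover have "subgroup (?S v \<inter> ?S w) G"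
      using sub group.subgroups_Inter_pair group_hom group_hom.axioms(1) by metis
    ultimately show ?thesis using HS
      by - (rule exI[of _ "?S v \<inter> ?S w"], intro conjI disjI1)
  qed
next
  let ?S = "stabilizer G (act T)"
  assume "\<exists>K. subgroup K G \<and> H \<subseteq> K \<and> (?amalgam K \<or> ?ascending K)"
  then obtain K where K: "subgroup K G" "H \<subseteq> K" "?amalgam K \<or> ?ascending K"
    by (elim exE conjE)
  have KG: "K \<subseteq> carrier G" using K(1) by (rule subgroup.subset)
  from K(3) show "bi_elliptic G T H"
  proof
    assume "?amalgam K"
    then obtain A B where "subgroup A G" "subgroup B G" "K = A \<inter> B"
      "elliptic G T A" "elliptic G T B" "\<not> elliptic G T (generate G (A \<union> B))"
      by (elim exE conjE)
    then have AB: "A \<subseteq> carrier G" "B \<subseteq> carrier G" "K = A \<inter> B"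
      "elliptic G T A" "elliptic G T B" "\<not> elliptic G T (A \<union> B)"
      using elliptic_generate_iff[of "A \<union> B"] by (auto dest: subgroup.subset)
    then obtain v w where v: "v \<in> vertices T" "A \<subseteq> ?S v" and w: "w \<in> vertices T" "B \<subseteq> ?S w"
      using elliptic_iff_subset_stabilizer[OF AB(1)] elliptic_iff_subset_stabilizer[OF AB(2)]
      by blast
    \<comment> \<open>Otherwise \<open>A \<union> B\<close> would fix \<open>v\<close> and be
      elliptic.\<close>
    have "v \<noteq> w"
      using AB(1,2,6) v w elliptic_iff_subset_stabilizer[of "A \<union> B"] by auto
    moreover have "H \<subseteq> ?S v" "H \<subseteq> ?S w" using v w AB(3) K(2) by auto
    ultimately show ?thesis by (rule bi_elliptic_if_fixes_two_vertices[OF v(1) w(1)])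
  next
    assume "?ascending K"
    then obtain g where "elliptic G T K"
      and g: "hyperbolic G T g" "K \<subseteq> g <#\<^bsub>G\<^esub> K #>\<^bsub>G\<^esub> inv\<^bsub>G\<^esub> g"
      by (elim exE conjE)
    then obtain v where v: "v \<in> vertices T" "K \<subseteq> ?S v"
      using elliptic_iff_subset_stabilizer[OF KG] by blast
    have gG: "g \<in> carrier G" using g(1) by (simp add: hyperbolic_def)
    have "v \<noteq> act T g v"
      using g(1) v(1) elliptic_iff_subset_stabilizer[of "{g}"]
      by (auto simp: hyperbolic_def stabilizer_def)
    \<comment> \<open>For \<open>k\<close> in \<open>K\<close>, the element \<open>g^-1 k g\<close>
      lies in \<open>K\<close> and fixes \<open>v\<close>, so \<open>k\<close> fixes
      \<open>act T g v\<close>.\<close>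
    moreover have "K \<subseteq> ?S (act T g v)"
    proof
      fix k assume k: "k \<in> K"
      with KG have kG: "k \<in> carrier G" by auto
      have "inv\<^bsub>G\<^esub> g \<otimes>\<^bsub>G\<^esub> k \<otimes>\<^bsub>G\<^esub> g \<in> K"
        using k g(2) mem_conjugate_iff[OF gG KG kG] by auto
      with v(2) conjugate_mem_stabilizer_iff[OF gG kG v(1)] show "k \<in> ?S (act T g v)" by auto
    qed
    ultimately show ?thesis
      using v(2) K(2) bi_elliptic_if_fixes_two_vertices[OF v(1) element_image[OF gG v(1) refl], of H]
      by auto
  qed
qed

end

section \<open>Comparison of reduced trees in a deformation space\<close>

lemma G_tree_imp_tree_action:
  assumes "G_tree G T"
  shows "tree_action G T"
  using assms unfolding G_tree_def tree_action_def tree_action_axioms_def by blast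

text \<open>Every condition on the tree in \<open>bi_elliptic_iff\<close> can be read off from which
  subgroups are elliptic, and this agrees throughout a deformation space.\<close>

lemma deformation_space_bi_elliptic_iff:
  fixes T\<^sub>1 :: "('g, 'v1) action_tree" and T\<^sub>2 :: "('g, 'v2) action_tree"
  assumes G: "group G"
    and T1: "T\<^sub>1 \<in> deformation_space G T" "reduced G T\<^sub>1"
    and T2: "T\<^sub>2 \<in> deformation_space G T" "reduced G T\<^sub>2"
    and H: "subgroup H G"
  shows "bi_elliptic G T\<^sub>1 H \<longleftrightarrow> bi_elliptic G T\<^sub>2 H"
proof -
  interpret T1: tree_action G T\<^sub>1
    using T1(1) by (auto simp: deformation_space_def intro: G_tree_imp_tree_action)
  interpret T2: tree_action G T\<^sub>2
    using T2(1) by (auto simp: deformation_space_def intro: G_tree_imp_tree_action)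
  have ell: "elliptic G T\<^sub>1 K \<longleftrightarrow> elliptic G T\<^sub>2 K" if "subgroup K G" for K
    using T1(1) T2(1) that by (auto simp: deformation_space_def)
  have gen: "elliptic G T\<^sub>1 (generate G A) \<longleftrightarrow> elliptic G T\<^sub>2 (generate G A)"
    if "A \<subseteq> carrier G" for A
    using ell group.generate_is_subgroup[OF G that] by blast
  \<comment> \<open>A deformation space compares subgroups only, so \<open>{g}\<close> is replaced
    by the subgroup it generates.\<close>
  have hyp: "hyperbolic G T\<^sub>1 g \<longleftrightarrow> hyperbolic G T\<^sub>2 g" for g
    using gen[of "{g}"] T1.elliptic_generate_iff[of "{g}"] T2.elliptic_generate_iff[of "{g}"]
    by (auto simp: hyperbolic_def)
  have gen_Un: "elliptic G T\<^sub>1 (generate G (A \<union> B)) \<longleftrightarrow> elliptic G T\<^sub>2 (generate G (A \<union> B))"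
    if "subgroup A G" "subgroup B G" for A B
    using that by (intro gen) (auto dest: subgroup.subset)
  show ?thesis
    unfolding T1.bi_elliptic_iff[OF T1(2) H] T2.bi_elliptic_iff[OF T2(2) H]
    by (intro ex_cong1 conj_cong disj_cong refl arg_cong[of _ _ Not])
      (simp_all add: ell gen_Un hyp)
qed

theorem proposition4p6:
  fixes G :: "('g, 'm) monoid_scheme"
    and T :: "('g, 'v) action_tree"
    and T\<^sub>0 :: "('g, 'u) action_tree"
    and T\<^sub>1 :: "('g, 'v1) action_tree"
    and T\<^sub>2 :: "('g, 'v2) action_tree"
  assumes "finitely_generated_group G"
  shows
    "(G_tree G T \<and> reduced G T \<longrightarrow>
       (\<forall>H. subgroup H G \<longrightarrow>
         (bi_elliptic G T H \<longleftrightarrow>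
           (\<exists>K. subgroup K G \<and> H \<subseteq> K \<and>
             ((\<exists>A B. subgroup A G \<and> subgroup B G \<and> K = A \<inter> B \<and>
                 elliptic G T A \<and> elliptic G T B \<and> \<not> elliptic G T (generate G (A \<union> B))) \<or>
              (elliptic G T K \<and>
                 (\<exists>g. hyperbolic G T g \<and> K \<subseteq> g <#\<^bsub>G\<^esub> K #>\<^bsub>G\<^esub> inv\<^bsub>G\<^esub> g)))))))
     \<and>
     (G_tree G T\<^sub>0 \<and>
       T\<^sub>1 \<in> deformation_space G T\<^sub>0 \<and> reduced G T\<^sub>1 \<and>
       T\<^sub>2 \<in> deformation_space G T\<^sub>0 \<and> reduced G T\<^sub>2 \<longrightarrow>
       (\<forall>H. subgroup H G \<longrightarrow> (bi_elliptic G T\<^sub>1 H \<longleftrightarrow> bi_elliptic G T\<^sub>2 H)))"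
proof (intro conjI impI allI)
  fix H assume "G_tree G T \<and> reduced G T" "subgroup H G"
  then show "bi_elliptic G T H \<longleftrightarrow>
    (\<exists>K. subgroup K G \<and> H \<subseteq> K \<and>
      ((\<exists>A B. subgroup A G \<and> subgroup B G \<and> K = A \<inter> B \<and>
          elliptic G T A \<and> elliptic G T B \<and> \<not> elliptic G T (generate G (A \<union> B))) \<or>
       (elliptic G T K \<and>
          (\<exists>g. hyperbolic G T g \<and> K \<subseteq> g <#\<^bsub>G\<^esub> K #>\<^bsub>G\<^esub> inv\<^bsub>G\<^esub> g))))"
    by (intro tree_action.bi_elliptic_iff G_tree_imp_tree_action) simp_all
next
  fix H assume "G_tree G T\<^sub>0 \<and>
    T\<^sub>1 \<in> deformation_space G T\<^sub>0 \<and> reduced G T\<^sub>1 \<and>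
    T\<^sub>2 \<in> deformation_space G T\<^sub>0 \<and> reduced G T\<^sub>2" "subgroup H G"
  moreover have "group G" using assms by (simp add: finitely_generated_group_def)
  ultimately show "bi_elliptic G T\<^sub>1 H \<longleftrightarrow> bi_elliptic G T\<^sub>2 H"
    by (intro deformation_space_bi_elliptic_iff[where T = T\<^sub>0]) simp_all
qed

end
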